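(* Let $\rho$ be a qubit state (a density operator on $\mathbb{C}^2$), and let $\mathbb{X}=\{|x\rangle\}$ and $\mathbb{Z}=\{|z\rangle\}$ be two measurement bases (orthonormal bases) of $\mathbb{C}^2$. Let $c=\max_{|x\rangle\in\mathbb{X},\,|z\rangle\in\mathbb{Z}}|\langle x|z\rangle|^2$ and let $P=\mathrm{Tr}[\rho^2]$. Then $$C^{\mathbb{X}}_{l_1}(\rho)+C^{\mathbb{Z}}_{l_1}(\rho)\ \ge\ 2\sqrt{(2P-1)\,c\,(1-c)}.$$
   Context: For an orthonormal basis $\mathbb{J}=\{|i\rangle\}$, the $l_1$ norm of coherence of a density operator $\rho$ is $C^{\mathbb{J}}_{l_1}(\rho)=\sum_{i\neq j}|\langle i|\rho|j\rangle|$, the sum of the absolute values of the off-diagonal entries of $\rho$ in the basis $\mathbb{J}$. *)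

theory Defs
  imports "HOL-Analysis.Analysis"
begin

text \<open>
  The library's inner product on \<^typ>\<open>complex ^ 'n\<close> is the real-valued one. The Hermitian inner
  product below follows the physics convention: conjugate-linear in the first argument.
\<close>
definition braket :: "complex ^ 'n \<Rightarrow> complex ^ 'n \<Rightarrow> complex" where
  "braket u v = (\<Sum>k\<in>UNIV. cnj (u $ k) * v $ k)"

definition conj_transpose :: "complex ^ 'n ^ 'm \<Rightarrow> complex ^ 'm ^ 'n" where
  "conj_transpose A = (\<chi> i j. cnj (A $ j $ i))"

definition hermitian :: "complex ^ 'n ^ 'n \<Rightarrow> bool" where
  "hermitian A \<longleftrightarrow> conj_transpose A = A"

text \<open>For Hermitian \<open>A\<close> the number \<open>braket v (A *v v)\<close> is real, so taking \<^const>\<open>Re\<close> loses nothing.\<close>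
definition positive_semidefinite :: "complex ^ 'n ^ 'n \<Rightarrow> bool" where
  "positive_semidefinite A \<longleftrightarrow> hermitian A \<and> (\<forall>v. 0 \<le> Re (braket v (A *v v)))"

definition density_operator :: "complex ^ 'n ^ 'n \<Rightarrow> bool" where
  "density_operator \<rho> \<longleftrightarrow> positive_semidefinite \<rho> \<and> trace \<rho> = 1"

text \<open>The span is the complex one (\<open>vec.span\<close>), not the real span of the underlying real vector space.\<close>
definition orthonormal_basis :: "(complex ^ 'n) set \<Rightarrow> bool" where
  "orthonormal_basis B \<longleftrightarrow>
     (\<forall>u\<in>B. \<forall>v\<in>B. braket u v = (if u = v then 1 else 0)) \<and> vec.span B = UNIV"

definition l1_coherence :: "(complex ^ 'n) set \<Rightarrow> complex ^ 'n ^ 'n \<Rightarrow> real" where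
  "l1_coherence B \<rho> = (\<Sum>i\<in>B. \<Sum>j\<in>B - {i}. cmod (braket i (\<rho> *v j)))"

text \<open>The trace is real for every density operator; see \<open>of_real_purity\<close>.\<close>
definition purity :: "complex ^ 'n ^ 'n \<Rightarrow> real" where
  "purity \<rho> = Re (trace (\<rho> ** \<rho>))"

lemma of_real_purity:
  fixes \<rho> :: "complex ^ 'n ^ 'n"
  assumes "density_operator \<rho>"
  shows "complex_of_real (purity \<rho>) = trace (\<rho> ** \<rho>)"
proof -
  have herm: "hermitian \<rho>"
    using assms by (simp add: density_operator_def positive_semidefinite_def)
  have h: "cnj (\<rho> $ j $ i) = \<rho> $ i $ j" for i j
  proof -
    have "conj_transpose \<rho> $ i $ j = \<rho> $ i $ j"
      using herm unfolding hermitian_def by (rule arg_cong)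
    then show ?thesis
      unfolding conj_transpose_def vec_lambda_beta .
  qed
  have tr: "trace (\<rho> ** \<rho>) = (\<Sum>i\<in>UNIV. \<Sum>k\<in>UNIV. \<rho> $ i $ k * \<rho> $ k $ i)"
    unfolding trace_def matrix_matrix_mult_def vec_lambda_beta ..
  have "cnj (trace (\<rho> ** \<rho>)) = (\<Sum>i\<in>UNIV. \<Sum>k\<in>UNIV. \<rho> $ k $ i * \<rho> $ i $ k)"
    unfolding tr cnj_sum complex_cnj_mult h ..
  also have "\<dots> = trace (\<rho> ** \<rho>)"
    unfolding tr by (intro sum.cong refl mult.commute)
  finally have "trace (\<rho> ** \<rho>) \<in> \<real>"
    by (rule Reals_cnj_iff[THEN iffD2])
  then show ?thesis
    unfolding purity_def by (rule of_real_Re)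
qed

end

theory Submission
  imports Defs
begin

text \<open>
  Expand everything in the basis \<open>X\<close>: let \<open>\<rho>\<close> have diagonal difference \<open>D\<close> and off-diagonal entry
  \<open>b\<close>, and let a vector of \<open>Z\<close> have coordinates \<open>(\<alpha>, \<beta>)\<close>. Then \<open>2 P - 1 = D\<^sup>2 + 4 \<bar>b\<bar>\<^sup>2\<close>,
  \<open>c (1 - c) = \<bar>\<alpha>\<bar>\<^sup>2 \<bar>\<beta>\<bar>\<^sup>2\<close>, and the off-diagonal entry of \<open>\<rho>\<close> in \<open>Z\<close> is a quadratic expression in
  \<open>\<alpha>\<close> and \<open>\<beta>\<close>. In Bloch sphere terms the claim is the subadditivity of the sine: the sine of the
  angle between the two measurement axes is at most the sum of the sines of their angles to the
  Bloch vector.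
\<close>

section \<open>The Hermitian inner product and expansions in an orthonormal basis\<close>

lemma braket_add_right: "braket u (v + w) = braket u v + braket u w"
  by (simp add: braket_def algebra_simps sum.distrib)

lemma braket_scale_right: "braket u (a *s v) = a * braket u v"
  by (simp add: braket_def sum_distrib_left mult.left_commute)

lemma braket_zero_right: "braket u 0 = 0"
  by (simp add: braket_def)

lemma braket_sum_right: "braket u (\<Sum>i\<in>I. f i) = (\<Sum>i\<in>I. braket u (f i))"
  by (induction I rule: infinite_finite_induct) (simp_all add: braket_zero_right braket_add_right)

lemma cnj_braket: "cnj (braket u v) = braket v u"
  by (simp add: braket_def mult.commute)

lemma braket_hermitian:
  assumes "hermitian A"
  shows "braket u (A *v v) = braket (A *v u) v"
proof -
  have h: "A $ i $ j = cnj (A $ j $ i)" for i j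
    using assms by (simp add: hermitian_def conj_transpose_def vec_eq_iff)
  have "braket u (A *v v) = (\<Sum>i\<in>UNIV. \<Sum>j\<in>UNIV. cnj (u $ i) * A $ i $ j * v $ j)"
    by (simp add: braket_def matrix_vector_mult_def sum_distrib_left mult.assoc)
  also have "\<dots> = (\<Sum>j\<in>UNIV. \<Sum>i\<in>UNIV. cnj (u $ i) * A $ i $ j * v $ j)"
    by (rule sum.swap)
  also have "\<dots> = (\<Sum>j\<in>UNIV. \<Sum>i\<in>UNIV. cnj (A $ j $ i * u $ i) * v $ j)"
    by (intro sum.cong refl) (subst h, simp add: mult.commute)
  also have "\<dots> = braket (A *v u) v"
    by (simp add: braket_def matrix_vector_mult_def sum_distrib_right)
  finally show ?thesis .
qed

lemma orthonormal_basis_braket: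
  assumes "orthonormal_basis B" "u \<in> B" "v \<in> B"
  shows "braket u v = (if u = v then 1 else 0)"
  using assms by (simp add: orthonormal_basis_def)

lemma orthonormal_basis_independent:
  assumes "orthonormal_basis B"
  shows "vec.independent B"
  unfolding vec.independent_explicit_module
proof (intro allI impI)
  fix t f v
  assume t: "finite t" "t \<subseteq> B" "(\<Sum>v\<in>t. f v *s v) = 0" "v \<in> t"
  \<comment> \<open>Pairing the vanishing combination with \<open>v\<close> isolates the coefficient
    \<open>f v\<close>.\<close>
  have "0 = braket v (\<Sum>w\<in>t. f w *s w)"
    using t by (simp add: braket_zero_right)
  also have "\<dots> = (\<Sum>w\<in>t. if v = w then f w else 0)"
    unfolding braket_sum_right braket_scale_right
    using t assms by (intro sum.cong) (auto simp: orthonormal_basis_braket subset_iff)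
  also have "\<dots> = f v"
    using t by simp
  finally show "f v = 0" by simp
qed

lemma orthonormal_basis_finite:
  assumes "orthonormal_basis B"
  shows "finite B"
  using vec.finiteI_independent[OF orthonormal_basis_independent[OF assms]] .

lemma orthonormal_basis_card:
  fixes B :: "(complex ^ 'n) set"
  assumes "orthonormal_basis B"
  shows "card B = CARD('n)"
proof -
  have "vec.dim (vec.span B) = card B"
    by (rule vec.dim_span_eq_card_independent[OF orthonormal_basis_independent[OF assms]])
  then show ?thesis
    using assms unfolding orthonormal_basis_def by (simp only: vec_dim_card)
qed

text \<open>Both sides are linear in \<open>v\<close> and agree on the vectors of \<open>B\<close>,
  so induction over the complex span applies.\<close>

lemma orthonormal_basis_expand:
  assumes B: "orthonormal_basis B"
  shows "v = (\<Sum>b\<in>B. braket b v *s b)"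
proof -
  have "v \<in> vec.span B"
    using B by (simp add: orthonormal_basis_def)
  then show ?thesis
  proof (induction rule: vec.span_induct_alt)
    case base
    show ?case by (simp add: braket_zero_right)
  next
    case (step a x y)
    have "(\<Sum>b\<in>B. braket b x *s b) = (\<Sum>b\<in>B. if b = x then b else 0)"
      using B step.hyps by (intro sum.cong) (auto simp: orthonormal_basis_braket)
    also have "\<dots> = x"
      using step.hyps orthonormal_basis_finite[OF B] by simp
    finally have x: "(\<Sum>b\<in>B. braket b x *s b) = x" .
    have "(\<Sum>b\<in>B. braket b (a *s x + y) *s b)
        = a *s (\<Sum>b\<in>B. braket b x *s b) + (\<Sum>b\<in>B. braket b y *s b)"
      by (simp add: braket_add_right braket_scale_right vec.scale_left_distrib sum.distrib
          vec.scale_sum_right)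
    then show ?case
      using x step.IH by simp
  qed
qed

lemma parseval:
  assumes "orthonormal_basis B"
  shows "braket u v = (\<Sum>b\<in>B. braket u b * braket b v)"
  by (subst orthonormal_basis_expand[OF assms, of v])
    (simp add: braket_sum_right braket_scale_right mult.commute)

section \<open>Matrix entries, trace and purity in an orthonormal basis\<close>

lemma matrix_vector_mult_expand:
  assumes B: "orthonormal_basis B"
  shows "A *v v = (\<Sum>b\<in>B. braket b v *s (A *v b))"
proof -
  have "A *v v = A *v (\<Sum>b\<in>B. braket b v *s b)"
    by (subst orthonormal_basis_expand[OF B, of v]) (rule refl)
  also have "\<dots> = (\<Sum>b\<in>B. A *v (braket b v *s b))"
    by (rule vec.linear_sum[OF matrix_vector_mul_linear_gen])
  finally show ?thesis
    by (simp add: vector_scalar_commute)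
qed

lemma braket_matrix_expand:
  assumes B: "orthonormal_basis B"
  shows "braket u (A *v v) = (\<Sum>i\<in>B. \<Sum>j\<in>B. braket u i * braket i (A *v j) * braket j v)"
proof -
  have "braket i (A *v v) = (\<Sum>j\<in>B. braket i (A *v j) * braket j v)" for i
    by (subst matrix_vector_mult_expand[OF B])
      (simp add: braket_sum_right braket_scale_right mult.commute)
  then show ?thesis
    by (subst parseval[OF B]) (simp add: sum_distrib_left mult.assoc)
qed

text \<open>Expanding the \<open>k\<close>-th axis vector in \<open>B\<close> turns the
  \<open>k\<close>-th diagonal entry of \<open>A\<close> into a sum over \<open>B\<close>; summing
  over \<open>k\<close> first then gives inner products.\<close>

lemma trace_orthonormal_basis:
  assumes B: "orthonormal_basis B"
  shows "trace A = (\<Sum>b\<in>B. braket b (A *v b))"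
proof -
  have axis: "braket u (axis k 1) = cnj (u $ k)" for u :: "complex ^ 'a" and k
    by (simp add: braket_def axis_def if_distrib cong: if_cong)
  have "A $ k $ k = (\<Sum>b\<in>B. cnj (b $ k) * (A *v b) $ k)" for k
  proof -
    have "A $ k $ k = (A *v axis k 1) $ k"
      by (simp add: matrix_vector_mult_def axis_def if_distrib cong: if_cong)
    also have "\<dots> = (\<Sum>b\<in>B. cnj (b $ k) * (A *v b) $ k)"
      by (subst matrix_vector_mult_expand[OF B]) (simp add: axis)
    finally show ?thesis .
  qed
  then have "trace A = (\<Sum>k\<in>UNIV. \<Sum>b\<in>B. cnj (b $ k) * (A *v b) $ k)"
    by (simp add: trace_def)
  also have "\<dots> = (\<Sum>b\<in>B. braket b (A *v b))"
    unfolding braket_def by (rule sum.swap)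
  finally show ?thesis .
qed

text \<open>For Hermitian \<open>A\<close> the trace of \<open>A ** A\<close> is the squared
  Hilbert-Schmidt norm, the sum of the squared lengths of the vectors \<open>A *v j\<close>;
  Parseval splits each length into entries.\<close>

lemma purity_orthonormal_basis:
  assumes B: "orthonormal_basis B" and A: "hermitian A"
  shows "purity A = (\<Sum>i\<in>B. \<Sum>j\<in>B. (cmod (braket i (A *v j)))\<^sup>2)"
proof -
  have "trace (A ** A) = (\<Sum>j\<in>B. braket (A *v j) (A *v j))"
    by (simp add: trace_orthonormal_basis[OF B] braket_hermitian[OF A]
        matrix_vector_mul_assoc[symmetric])
  also have "\<dots> = (\<Sum>j\<in>B. \<Sum>i\<in>B. braket (A *v j) i * braket i (A *v j))"
    by (intro sum.cong refl parseval[OF B])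
  also have "\<dots> = (\<Sum>j\<in>B. \<Sum>i\<in>B. complex_of_real ((cmod (braket i (A *v j)))\<^sup>2))"
    unfolding complex_norm_square cnj_braket by (simp add: mult.commute)
  also have "\<dots> = complex_of_real (\<Sum>i\<in>B. \<Sum>j\<in>B. (cmod (braket i (A *v j)))\<^sup>2)"
    by (subst sum.swap) simp
  finally show ?thesis
    by (simp add: purity_def)
qed

section \<open>The inequality in coordinates\<close>

text \<open>With \<open>k\<close> and \<open>2 * s\<close> as cosine and sine of the angle between
  the axes and \<open>(D, 2p, 2q)\<close> as Bloch vector, the two roots on the right are half its
  distances to the axes. After squaring, the term \<open>2 * k * p * E\<close> is absorbed by the
  product of the roots, and \<open>4 * s\<^sup>2 * q\<^sup>2\<close> by
  \<open>2 * q\<^sup>2\<close>.\<close>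

lemma sqrt_sum_ge_real:
  fixes s k p q D :: real
  assumes "k\<^sup>2 + 4 * s\<^sup>2 = 1" "s \<ge> 0"
  shows "s * sqrt (D\<^sup>2 + 4 * (p\<^sup>2 + q\<^sup>2)) \<le> sqrt (p\<^sup>2 + q\<^sup>2) + sqrt ((s * D - k * p)\<^sup>2 + q\<^sup>2)"
proof (rule power2_le_imp_le)
  define E where "E = s * D - k * p"
  have sD: "s * D = E + k * p"
    by (simp add: E_def)
  have "\<bar>p * E\<bar> = sqrt (p\<^sup>2) * sqrt (E\<^sup>2)"
    by (simp add: abs_mult)
  also have "\<dots> \<le> sqrt (p\<^sup>2 + q\<^sup>2) * sqrt (E\<^sup>2 + q\<^sup>2)"
    by (intro mult_mono) auto
  finally have cs: "\<bar>p * E\<bar> \<le> sqrt (p\<^sup>2 + q\<^sup>2) * sqrt (E\<^sup>2 + q\<^sup>2)" .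
  have "k\<^sup>2 \<le> 1" "4 * s\<^sup>2 \<le> 1"
    using assms(1) zero_le_power2[of s] zero_le_power2[of k] by linarith+
  then have "\<bar>k\<bar> \<le> 1"
    by (simp add: abs_square_le_1)
  then have kE: "k * (p * E) \<le> \<bar>p * E\<bar>"
    using mult_right_mono[of "\<bar>k\<bar>" 1 "\<bar>p * E\<bar>"] abs_ge_self[of "k * (p * E)"] by (simp add: abs_mult)
  have q: "4 * s\<^sup>2 * q\<^sup>2 \<le> q\<^sup>2"
    using mult_right_mono[OF \<open>4 * s\<^sup>2 \<le> 1\<close>, of "q\<^sup>2"] by simp
  have "(s * sqrt (D\<^sup>2 + 4 * (p\<^sup>2 + q\<^sup>2)))\<^sup>2 = (s * D)\<^sup>2 + 4 * s\<^sup>2 * p\<^sup>2 + 4 * s\<^sup>2 * q\<^sup>2"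
    by (simp add: power_mult_distrib algebra_simps)
  also have "\<dots> = (E + k * p)\<^sup>2 + (1 - k\<^sup>2) * p\<^sup>2 + 4 * s\<^sup>2 * q\<^sup>2"
    unfolding sD using assms(1) by algebra
  also have "\<dots> = E\<^sup>2 + p\<^sup>2 + 2 * (k * (p * E)) + 4 * s\<^sup>2 * q\<^sup>2"
    by (simp add: power2_eq_square algebra_simps)
  also have "\<dots> \<le> E\<^sup>2 + p\<^sup>2 + 2 * (sqrt (p\<^sup>2 + q\<^sup>2) * sqrt (E\<^sup>2 + q\<^sup>2)) + 2 * q\<^sup>2"
    using cs kE q zero_le_power2[of q] by linarith
  also have "\<dots> = (sqrt (p\<^sup>2 + q\<^sup>2) + sqrt (E\<^sup>2 + q\<^sup>2))\<^sup>2"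
    by (simp add: power2_sum)
  finally show "(s * sqrt (D\<^sup>2 + 4 * (p\<^sup>2 + q\<^sup>2)))\<^sup>2
      \<le> (sqrt (p\<^sup>2 + q\<^sup>2) + sqrt ((s * D - k * p)\<^sup>2 + q\<^sup>2))\<^sup>2"
    by (simp add: E_def)
qed simp

lemma off_diagonal_cmod_ge:
  fixes \<alpha> \<beta> b :: complex and D :: real
  assumes norm: "(cmod \<alpha>)\<^sup>2 + (cmod \<beta>)\<^sup>2 = 1"
  shows "cmod \<alpha> * cmod \<beta> * sqrt (D\<^sup>2 + 4 * (cmod b)\<^sup>2)
    \<le> cmod b + cmod (cnj \<alpha> * cnj \<beta> * of_real D - b * (cnj \<alpha>)\<^sup>2 + cnj b * (cnj \<beta>)\<^sup>2)"
\<comment> \<open>If the product vanishes, so does the left side; otherwise division by it is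
  allowed.\<close>
proof (cases "cmod \<alpha> * cmod \<beta> = 0")
  case False
  define s where "s = cmod \<alpha> * cmod \<beta>"
  define m n where "m = (cmod \<alpha>)\<^sup>2" and "n = (cmod \<beta>)\<^sup>2"
  define w where "w = cnj \<alpha> * cnj \<beta> * of_real D - b * (cnj \<alpha>)\<^sup>2 + cnj b * (cnj \<beta>)\<^sup>2"
  \<comment> \<open>The phase of \<open>cnj \<alpha> * \<beta>\<close> is absorbed into
    \<open>b\<close>, so that \<open>p\<close> and \<open>q\<close> are the real and imaginary parts
    of a number with the modulus of \<open>b\<close>.\<close>
  define u where "u = b * cnj \<alpha> * \<beta>"
  define p q where "p = Re u / s" and "q = Im u / s"
  have s: "s > 0"
    using False by (simp add: s_def)
  have re: "Re u = s * p" and im: "Im u = s * q"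
    using s by (simp_all add: p_def q_def)
  have mn: "m + n = 1" and ss: "s\<^sup>2 = m * n"
    using norm by (simp_all add: m_def n_def s_def power_mult_distrib)
  have "s * cmod b = cmod u"
    by (simp add: u_def s_def norm_mult)
  also have "\<dots> = sqrt (s\<^sup>2 * (p\<^sup>2 + q\<^sup>2))"
    by (simp add: cmod_def re im power_mult_distrib algebra_simps)
  finally have cb: "cmod b = sqrt (p\<^sup>2 + q\<^sup>2)"
    using s by (simp add: real_sqrt_mult)
  have aa: "\<alpha> * cnj \<alpha> = of_real m" "\<beta> * cnj \<beta> = of_real n"
    by (simp_all add: m_def n_def complex_norm_square del: of_real_power)
  \<comment> \<open>Multiplying by \<open>\<alpha> * \<beta>\<close> scales the modulus by
    \<open>s\<close> and cancels the phases: only \<open>m\<close>, \<open>n\<close>,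
    \<open>D\<close> and \<open>u\<close> remain.\<close>
  have "w * (\<alpha> * \<beta>) = (\<alpha> * cnj \<alpha>) * (\<beta> * cnj \<beta>) * of_real D - (\<alpha> * cnj \<alpha>) * u + (\<beta> * cnj \<beta>) * cnj u"
    by (simp add: w_def u_def power2_eq_square algebra_simps)
  also have "\<dots> = Complex (m * n * D - (m - n) * Re u) (- (m + n) * Im u)"
    unfolding aa by (simp add: complex_eq_iff algebra_simps)
  also have "\<dots> = Complex (s * (s * D - (m - n) * p)) (s * (- q))"
    unfolding ss[symmetric] mn re im by (simp add: power2_eq_square algebra_simps)
  finally have "cmod (w * (\<alpha> * \<beta>)) = sqrt (s\<^sup>2 * ((s * D - (m - n) * p)\<^sup>2 + q\<^sup>2))"
    by (simp only: complex_norm power_mult_distrib distrib_left power2_minus)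
  then have cw: "cmod w = sqrt ((s * D - (m - n) * p)\<^sup>2 + q\<^sup>2)"
    using s by (simp add: norm_mult real_sqrt_mult flip: s_def)
  \<comment> \<open>The difference \<open>m - n\<close> takes the role of \<open>k\<close> in the
    real inequality.\<close>
  have "(m - n)\<^sup>2 + 4 * s\<^sup>2 = (m + n)\<^sup>2"
    unfolding ss by (simp add: power2_eq_square algebra_simps)
  then have "(m - n)\<^sup>2 + 4 * s\<^sup>2 = 1"
    by (simp add: mn)
  from sqrt_sum_ge_real[OF this, of D p q] s show ?thesis
    by (simp add: cb flip: cw s_def w_def)
qed auto

text \<open>The second row of a unitary matrix is determined by the first up to the phase \<open>e\<close>.\<close>
lemma orthonormal_pair_phase:
  fixes \<alpha> \<beta> \<gamma> \<delta> :: complex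
  assumes n1: "cnj \<alpha> * \<alpha> + cnj \<beta> * \<beta> = 1" and n2: "cnj \<gamma> * \<gamma> + cnj \<delta> * \<delta> = 1"
    and o: "cnj \<alpha> * \<gamma> + cnj \<beta> * \<delta> = 0"
  obtains e where "cmod e = 1" "\<gamma> = - e * cnj \<beta>" "\<delta> = e * cnj \<alpha>"
proof -
  \<comment> \<open>The phase is the determinant of the matrix with rows
    \<open>(\<alpha>, \<beta>)\<close> and \<open>(\<gamma>, \<delta>)\<close>; the two identities
    below are Cramer's rule for \<open>n1\<close> and \<open>o\<close> read as linear
    equations.\<close>
  define e where "e = \<alpha> * \<delta> - \<beta> * \<gamma>"
  have "e * cnj \<alpha> = \<delta> * (cnj \<alpha> * \<alpha> + cnj \<beta> * \<beta>) - \<beta> * (cnj \<alpha> * \<gamma> + cnj \<beta> * \<delta>)"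
    by (simp add: e_def algebra_simps)
  then have d: "\<delta> = e * cnj \<alpha>"
    by (simp add: n1 o)
  have "- e * cnj \<beta> = \<gamma> * (cnj \<alpha> * \<alpha> + cnj \<beta> * \<beta>) - \<alpha> * (cnj \<alpha> * \<gamma> + cnj \<beta> * \<delta>)"
    by (simp add: e_def algebra_simps)
  then have g: "\<gamma> = - e * cnj \<beta>"
    by (simp add: n1 o)
  have "cnj e * e * (cnj \<alpha> * \<alpha> + cnj \<beta> * \<beta>) = 1"
    using n2 unfolding d g by (simp add: algebra_simps)
  then have "complex_of_real ((cmod e)\<^sup>2) = 1"
    unfolding n1 complex_norm_square by (simp add: mult.commute)
  then have "(cmod e)\<^sup>2 = 1"
    using of_real_eq_1_iff by blast
  then have "cmod e = 1"
    by (simp add: power2_eq_1_iff) (smt (verit) norm_ge_zero)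
  with d g that show thesis by blast
qed

text \<open>The two off-diagonal entries of a Hermitian matrix are conjugate, so they contribute
  equally.\<close>

lemma l1_coherence_pair:
  assumes "hermitian A" "x \<noteq> y"
  shows "l1_coherence {x, y} A = 2 * cmod (braket x (A *v y))"
proof -
  have "cmod (braket y (A *v x)) = cmod (braket x (A *v y))"
    by (metis assms(1) braket_hermitian cnj_braket complex_mod_cnj)
  moreover have "{x, y} - {x} = {y}" "{x, y} - {y} = {x}"
    using assms(2) by auto
  ultimately show ?thesis
    using assms(2) by (simp add: l1_coherence_def)
qed

theorem theorem4:
  fixes \<rho> :: "complex ^ 2 ^ 2" and X Z :: "(complex ^ 2) set" and c P :: real
  assumes "density_operator \<rho>"
    and "orthonormal_basis X" and "orthonormal_basis Z"
    and "c = Max {(cmod (braket x z))\<^sup>2 | x z. x \<in> X \<and> z \<in> Z}"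
    and "P = purity \<rho>"
  shows "l1_coherence X \<rho> + l1_coherence Z \<rho> \<ge> 2 * sqrt ((2 * P - 1) * c * (1 - c))"
proof -
  have herm: "hermitian \<rho>" and tr: "trace \<rho> = 1"
    using assms(1) by (simp_all add: density_operator_def positive_semidefinite_def)
  obtain x y where X: "X = {x, y}" and xy: "x \<noteq> y"
    using orthonormal_basis_card[OF assms(2)] by (auto simp: card_2_iff)
  obtain z t where Z: "Z = {z, t}" and zt: "z \<noteq> t"
    using orthonormal_basis_card[OF assms(3)] by (auto simp: card_2_iff)
  define \<alpha> \<beta> \<gamma> \<delta> where "\<alpha> = braket x z" and "\<beta> = braket y z"
    and "\<gamma> = braket x t" and "\<delta> = braket y t"
  have coords: "braket z x = cnj \<alpha>" "braket z y = cnj \<beta>" "braket t x = cnj \<gamma>" "braket t y = cnj \<delta>"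
    by (simp_all add: \<alpha>_def \<beta>_def \<gamma>_def \<delta>_def cnj_braket)
  have inner: "braket v w = braket v x * braket x w + braket v y * braket y w" for v w
    using parseval[OF assms(2), of v w] xy by (simp add: X)
  have n1: "cnj \<alpha> * \<alpha> + cnj \<beta> * \<beta> = 1"
    using inner[of z z] orthonormal_basis_braket[OF assms(3), of z z]
    by (simp add: coords Z flip: \<alpha>_def \<beta>_def)
  have n2: "cnj \<gamma> * \<gamma> + cnj \<delta> * \<delta> = 1"
    using inner[of t t] orthonormal_basis_braket[OF assms(3), of t t]
    by (simp add: coords Z flip: \<gamma>_def \<delta>_def)
  have o: "cnj \<alpha> * \<gamma> + cnj \<beta> * \<delta> = 0"
    using inner[of z t] orthonormal_basis_braket[OF assms(3), of z t] zt
    by (simp add: coords Z flip: \<gamma>_def \<delta>_def)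
  obtain e where e: "cmod e = 1" and g: "\<gamma> = - e * cnj \<beta>" and d: "\<delta> = e * cnj \<alpha>"
    using orthonormal_pair_phase[OF n1 n2 o] .

  define m n where "m = (cmod \<alpha>)\<^sup>2" and "n = (cmod \<beta>)\<^sup>2"
  have "complex_of_real (m + n) = 1"
    unfolding m_def n_def of_real_add complex_norm_square using n1 by (simp add: mult.commute)
  then have mn: "m + n = 1"
    using of_real_eq_1_iff by blast
  \<comment> \<open>The phase relation gives \<open>\<gamma>\<close> the modulus of
    \<open>\<beta>\<close> and \<open>\<delta>\<close> that of \<open>\<alpha>\<close>, so only two
    overlaps occur. They sum to 1, hence \<open>c * (1 - c)\<close> is their product whichever is
    larger.\<close>
  have "{(cmod (braket x z))\<^sup>2 | x z. x \<in> X \<and> z \<in> Z}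
      = {(cmod \<alpha>)\<^sup>2, (cmod \<beta>)\<^sup>2, (cmod \<gamma>)\<^sup>2, (cmod \<delta>)\<^sup>2}"
    unfolding X Z \<alpha>_def \<beta>_def \<gamma>_def \<delta>_def by blast
  also have "\<dots> = {m, n}"
    by (auto simp: g d e norm_mult m_def n_def)
  finally have "c = max m n"
    using assms(4) by simp
  then have "c = m \<and> 1 - c = n \<or> c = n \<and> 1 - c = m"
    using mn by (auto simp: max_def)
  then have c: "c * (1 - c) = (cmod \<alpha> * cmod \<beta>)\<^sup>2"
    by (auto simp: m_def n_def power_mult_distrib mult.commute)

  define b where "b = braket x (\<rho> *v y)"
  define A where "A = Re (braket x (\<rho> *v x))"
  define D where "D = Re (braket y (\<rho> *v y))"
  have real: "braket v (\<rho> *v v) = of_real (Re (braket v (\<rho> *v v)))" for v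
    by (metis braket_hermitian cnj_braket herm of_real_Re Reals_cnj_iff)
  have entries: "braket x (\<rho> *v x) = of_real A" "braket y (\<rho> *v y) = of_real D"
      "braket x (\<rho> *v y) = b" "braket y (\<rho> *v x) = cnj b"
    unfolding A_def D_def b_def by (rule real real refl)+ (metis braket_hermitian cnj_braket herm)
  have "complex_of_real (A + D) = 1"
    using trace_orthonormal_basis[OF assms(2), of \<rho>] tr xy by (simp add: X entries)
  then have AD: "A + D = 1"
    using of_real_eq_1_iff by blast
  have "P = A\<^sup>2 + D\<^sup>2 + 2 * (cmod b)\<^sup>2"
    using xy by (simp add: assms(5) purity_orthonormal_basis[OF assms(2) herm] X entries)
  \<comment> \<open>Subtracting \<open>(A + D)\<^sup>2 = 1\<close> from
    \<open>2 * (A\<^sup>2 + D\<^sup>2)\<close> leaves \<open>(A - D)\<^sup>2\<close>.\<close>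
  then have P: "2 * P - 1 = (A - D)\<^sup>2 + 4 * (cmod b)\<^sup>2"
    using AD by algebra

  have "braket z (\<rho> *v t) = cnj \<alpha> * of_real A * \<gamma> + cnj \<alpha> * b * \<delta>
      + (cnj \<beta> * cnj b * \<gamma> + cnj \<beta> * of_real D * \<delta>)"
    using braket_matrix_expand[OF assms(2), of z \<rho> t] xy
    by (simp add: X entries coords flip: \<gamma>_def \<delta>_def)
  \<comment> \<open>Inserting the phase relation pulls out \<open>- e\<close>, of modulus 1, and
    leaves the expression of \<open>off_diagonal_cmod_ge\<close> with diagonal difference
    \<open>A - D\<close>.\<close>
  also have "\<dots> = - e * (cnj \<alpha> * cnj \<beta> * of_real (A - D) - b * (cnj \<alpha>)\<^sup>2 + cnj b * (cnj \<beta>)\<^sup>2)"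
    by (simp add: g d power2_eq_square algebra_simps)
  finally have "cmod (braket z (\<rho> *v t))
      = cmod (cnj \<alpha> * cnj \<beta> * of_real (A - D) - b * (cnj \<alpha>)\<^sup>2 + cnj b * (cnj \<beta>)\<^sup>2)"
    by (simp only: norm_mult norm_minus_cancel e mult_1)
  then have "cmod \<alpha> * cmod \<beta> * sqrt (2 * P - 1) \<le> cmod b + cmod (braket z (\<rho> *v t))"
    unfolding P using off_diagonal_cmod_ge[of \<alpha> \<beta> "A - D" b] mn by (simp add: m_def n_def)
  moreover have "sqrt ((2 * P - 1) * c * (1 - c)) = cmod \<alpha> * cmod \<beta> * sqrt (2 * P - 1)"
    unfolding mult.assoc c by (simp add: real_sqrt_mult)
  ultimately show ?thesis
    unfolding X Z l1_coherence_pair[OF herm xy] l1_coherence_pair[OF herm zt] b_def by simp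
qed

end
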